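(* The almost Golomb sequence $(a(n))$ of order $2$ satisfies $$a(2n)=a(n)+a(n+1)-1\quad(n\ge 1),\qquad a(2n+1)=a(n)+a(n+1)\quad(n\ge 2).$$ In particular $(a(n))$ is $2$-regular.
   Context: The almost Golomb sequence of order $2$ is the nondecreasing sequence of positive integers $(a(n))_{n\ge 1}$, extended by $a(0)=0$, such that $a\bigl(a(n)+a(n-1)\bigr)=n$ for every $n\ge 1$ and such that, for every $n\ge 2$, no integer $m$ with $a(n-1)\le m<a(n)$ satisfies $a\bigl(m+a(n-1)\bigr)=n$. It begins $1,2,2,3,4,4,5,6,7,7,8,8,9,\ldots$ An integer-valued sequence $(f(n))_{n\ge0}$ is $2$-regular if the $\mathbb{Z}$-module spanned by its $2$-kernel $\{(f(2^i n+j))_{n\ge 0}: i\ge 0,\ 0\le j<2^i\}$ is finitely generated.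
   Formalization: The condition that no m with a(n-1) ≤ m < a(n) satisfies a(m+a(n-1)) = n is imposed only for n ≥ 3; at n = 2 the other conditions force a(1)=1, a(2)=2, so m = 1 violates it and no sequence would qualify. *)

theory Defs
  imports Complex_Main "HOL-Library.Function_Algebras"
begin

text \<open>
  The last condition says that, going up from \<open>2 * a (n - 1)\<close>, the value \<open>n\<close> is not reached before
  position \<open>a n + a (n - 1)\<close>.  It is imposed for \<open>n \<ge> 3\<close> only: the other conditions
  force \<open>a 1 = 1\<close> and \<open>a 2 = 2\<close>, so for \<open>n = 2\<close> it always fails, with witness \<open>m = 1\<close>
  (lemma \<open>no_minimality_at_2\<close>).  With \<open>n \<ge> 2\<close> the predicate would be empty; as it is, it
  is satisfied (lemma \<open>almost_golomb2_exists\<close>).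
  The number \<open>m\<close> may be taken to be a natural number since \<open>a (n - 1) \<ge> 0\<close>.
\<close>

definition almost_golomb2 :: "(nat \<Rightarrow> nat) \<Rightarrow> bool" where
  "almost_golomb2 a \<longleftrightarrow>
     a 0 = 0 \<and>
     (\<forall>n\<ge>1. a n > 0) \<and>
     (\<forall>m n. 1 \<le> m \<and> m \<le> n \<longrightarrow> a m \<le> a n) \<and>
     (\<forall>n\<ge>1. a (a n + a (n - 1)) = n) \<and>
     (\<forall>n\<ge>3. \<not> (\<exists>m. a (n - 1) \<le> m \<and> m < a n \<and> a (m + a (n - 1)) = n))"

lemma no_minimality_at_2:
  fixes a :: "nat \<Rightarrow> nat"
  assumes zero: "a 0 = 0"
    and pos: "\<And>n. n \<ge> 1 \<Longrightarrow> a n > 0"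
    and mono: "\<And>m n. 1 \<le> m \<Longrightarrow> m \<le> n \<Longrightarrow> a m \<le> a n"
    and rec: "\<And>n. n \<ge> 1 \<Longrightarrow> a (a n + a (n - 1)) = n"
  shows "a 1 = 1" "a 2 = 2" "\<exists>m. a (2 - 1) \<le> m \<and> m < a 2 \<and> a (m + a (2 - 1)) = 2"
proof -
  have "a (a 1) = 1" using rec[of 1] zero by simp
  moreover have "a 1 \<ge> 1" using pos[of 1] by simp
  ultimately show a1: "a 1 = 1" using mono[of 1 "a 1"] by simp
  have r: "a (a 2 + 1) = 2" using rec[of 2] a1 by simp
  have "a 2 \<ge> 1" using pos[of 2] by simp
  then have "a 2 \<le> 2" using mono[of 2 "a 2 + 1"] r by simp
  moreover have "a 2 \<noteq> 1" using r by (auto simp: numeral_2_eq_2)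
  ultimately show a2: "a 2 = 2" using \<open>a 2 \<ge> 1\<close> by simp
  show "\<exists>m. a (2 - 1) \<le> m \<and> m < a 2 \<and> a (m + a (2 - 1)) = 2"
    using a1 a2 by (intro exI[of _ 1]) (simp add: numeral_2_eq_2)
qed

fun golomb_witness :: "nat \<Rightarrow> nat" where
  "golomb_witness k =
     (if k < 3 then k else if k = 3 then 2
      else golomb_witness (k div 2) + golomb_witness (k div 2 + 1) - (if even k then 1 else 0))"

declare golomb_witness.simps [simp del]

lemma almost_golomb2_exists: "\<exists>a. almost_golomb2 a"
proof -
  define b where "b = golomb_witness"
  have b0: "b 0 = 0" and b1: "b 1 = 1" and b2: "b 2 = 2" and b3: "b 3 = 2"
    by (simp_all add: b_def golomb_witness.simps)
  have ev: "b (2 * n) = b n + b (n + 1) - 1" if "n \<ge> 2" for n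
    using that unfolding b_def by (subst golomb_witness.simps) auto
  have od: "b (2 * n + 1) = b n + b (n + 1)" if "n \<ge> 2" for n
    using that unfolding b_def by (subst golomb_witness.simps) auto
  have b4: "b 4 = 3" using ev[of 2] b2 b3 by simp
  have b5: "b 5 = 4" using od[of 2] b2 b3 by simp
  have step: "b n \<ge> 1 \<and> (b (n + 1) = b n \<or> b (n + 1) = b n + 1)
      \<and> (b (n + 1) = b n \<longrightarrow> b (n + 2) = b (n + 1) + 1)
      \<and> (n \<ge> 4 \<and> even n \<longrightarrow> b (n + 1) = b n + 1)" if "n \<ge> 1" for n
    using that
  proof (induction n rule: less_induct)
    case (less n)
    consider "n = 1" | "n = 2" | "n = 3" | k where "k \<ge> 2" "n = 2 * k" | k where "k \<ge> 2" "n = 2 * k + 1"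
    proof -
      assume *: "n = 1 \<Longrightarrow> thesis" "n = 2 \<Longrightarrow> thesis" "n = 3 \<Longrightarrow> thesis"
        "\<And>k. 2 \<le> k \<Longrightarrow> n = 2 * k \<Longrightarrow> thesis" "\<And>k. 2 \<le> k \<Longrightarrow> n = 2 * k + 1 \<Longrightarrow> thesis"
      show thesis
      proof (cases "n \<ge> 4")
        case True
        then show thesis using *(4,5)[of "n div 2"] by (cases "even n") auto
      next
        case False
        then have "n = 1 \<or> n = 2 \<or> n = 3" using less.prems by auto
        then show thesis using *(1-3) by auto
      qed
    qed
    then show ?case
    proof cases
      case 1
      then show ?thesis using b1 b2 b3 by (simp add: numeral_eq_Suc)
    next
      case 2
      then show ?thesis using b2 b3 b4 by (simp add: numeral_eq_Suc)
    next
      case 3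
      then show ?thesis using b3 b4 b5 by (simp add: numeral_eq_Suc)
    next
      case (4 k)
      have "b k \<ge> 1" using less.IH[of k] 4 by simp
      moreover have "b (n + 1) = b k + b (k + 1)" using od[of k] 4 by simp
      moreover have "b n = b k + b (k + 1) - 1" using ev[of k] 4 by simp
      moreover have "b (k + 1) \<ge> 1" using less.IH[of "k + 1"] 4 by simp
      ultimately show ?thesis by auto
    next
      case (5 k)
      have e1: "b n = b k + b (k + 1)" using od[of k] 5 by simp
      have e2: "b (n + 1) = b (k + 1) + b (k + 2) - 1" using ev[of "k + 1"] 5 by simp
      have e3: "b (n + 2) = b (k + 1) + b (k + 2)" using od[of "k + 1"] 5 by simp
      have i1: "b k \<ge> 1 \<and> (b (k + 1) = b k \<or> b (k + 1) = b k + 1)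
          \<and> (b (k + 1) = b k \<longrightarrow> b (k + 2) = b (k + 1) + 1)
          \<and> (k \<ge> 4 \<and> even k \<longrightarrow> b (k + 1) = b k + 1)"
        using less.IH[of k] 5 by simp
      have i2: "b (k + 1) \<ge> 1 \<and> (b (k + 2) = b (k + 1) \<or> b (k + 2) = b (k + 1) + 1)"
        using less.IH[of "k + 1"] 5 by (simp add: numeral_eq_Suc)
      show ?thesis using e1 e2 e3 i1 i2 5 by auto
    qed
  qed
  have mono: "b m \<le> b n" if "m \<le> n" for m n
  proof (rule lift_Suc_mono_le[OF _ that])
    fix n show "b n \<le> b (Suc n)" using step[of n] b0 by (cases "n = 0") auto
  qed
  have key: "b (b n + b (n - 1)) = n \<and> (n \<ge> 3 \<longrightarrow> b (b n + b (n - 1) - 1) = n - 1)"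
    if "n \<ge> 1" for n
    using that
  proof (induction n rule: less_induct)
    case (less n)
    consider "n = 1" | "n = 2" | "n = 3" | "n = 4" | k where "k \<ge> 3" "n = 2 * k"
      | k where "k \<ge> 2" "n = 2 * k + 1"
    proof -
      assume *: "n = 1 \<Longrightarrow> thesis" "n = 2 \<Longrightarrow> thesis" "n = 3 \<Longrightarrow> thesis" "n = 4 \<Longrightarrow> thesis"
        "\<And>k. 3 \<le> k \<Longrightarrow> n = 2 * k \<Longrightarrow> thesis" "\<And>k. 2 \<le> k \<Longrightarrow> n = 2 * k + 1 \<Longrightarrow> thesis"
      show thesis
      proof (cases "n \<ge> 5")
        case True
        then show thesis using *(5,6)[of "n div 2"] by (cases "even n") auto
      next
        case False
        then have "n = 1 \<or> n = 2 \<or> n = 3 \<or> n = 4" using less.prems by auto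
        then show thesis using *(1-4) by auto
      qed
    qed
    then show ?case
    proof cases
      case 1
      then show ?thesis using b0 b1 by simp
    next
      case 2
      then show ?thesis using b1 b2 b3 by simp
    next
      case 3
      then show ?thesis using b2 b3 b4 by simp
    next
      case 4
      then show ?thesis using b3 b4 b5 by simp
    next
      case (5 k)
      define s where "s = b k + b (k - 1)"
      define t where "t = b (k + 1) + b k"
      obtain j where j: "k = Suc j" "j \<ge> 2" using 5 by (cases k) auto
      have s: "b s = k" "b (s - 1) = k - 1" using less.IH[of k] 5 s_def by auto
      have t: "b t = k + 1" "b (t - 1) = k" using less.IH[of "k + 1"] 5 t_def by auto
      have pj: "b j \<ge> 2" using mono[of 2 j] j b2 by simp
      have s4: "s \<ge> 4" using s_def j pj mono[of j k] by simp
      have ts: "t = s + 1 \<or> t = s + 2"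
        using step[of j] j s_def t_def step[of k] by (auto simp: numeral_eq_Suc)
      have n1: "b n = t - 1" using ev[of k] 5 t_def by simp
      have "n - 1 = 2 * j + 1" using 5 j by simp
      then have n2: "b (n - 1) = s" using od[of j] j s_def by simp
      show ?thesis
        using ts
      proof
        assume T: "t = s + 1"
        obtain r where r: "s = Suc r" using s4 by (cases s) auto
        have "b (2 * s) = 2 * k" using ev[of s] s4 s t T by simp
        moreover have "b (2 * r + 1) = k - 1 + k" using od[of r] s4 s r by simp
        ultimately show ?thesis using n1 n2 T 5 r
          by (simp add: mult_2)
      next
        assume T: "t = s + 2"
        have "b (2 * s + 1) = 2 * k" using od[of s] s4 s t T by simp
        moreover have "b (2 * s) = 2 * k - 1" using ev[of s] s4 s t T by simp
        ultimately show ?thesis using n1 n2 T 5 by (simp add: mult_2)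
      qed
    next
      case (6 k)
      define t where "t = b (k + 1) + b k"
      have t: "b t = k + 1" "b (t - 1) = k" using less.IH[of "k + 1"] 6 t_def by auto
      have "b k \<ge> 2" using mono[of 2 k] 6 b2 by simp
      then have t4: "t \<ge> 4" using t_def mono[of k "k + 1"] by simp
      have n1: "b n = t" using od[of k] 6 t_def by simp
      have n2: "b (n - 1) = t - 1" using ev[of k] 6 t_def by simp
      obtain r where r: "t = Suc r" using t4 by (cases t) auto
      have "b (2 * r + 1) = 2 * k + 1" using od[of r] t4 t r by simp
      moreover have "b (2 * r) = 2 * k" using ev[of r] t4 t r by simp
      ultimately show ?thesis using n1 n2 6 r by (simp add: mult_2)
    qed
  qed
  have "\<not> (\<exists>m. b (n - 1) \<le> m \<and> m < b n \<and> b (m + b (n - 1)) = n)" if "n \<ge> 3" for n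
  proof
    assume "\<exists>m. b (n - 1) \<le> m \<and> m < b n \<and> b (m + b (n - 1)) = n"
    then obtain m where m: "m < b n" "b (m + b (n - 1)) = n" by blast
    then have "n \<le> b (b n + b (n - 1) - 1)"
      using mono[of "m + b (n - 1)" "b n + b (n - 1) - 1"] by simp
    then show False using key[of n] that by simp
  qed
  moreover have "b n > 0" if "n \<ge> 1" for n using step[of n] that by simp
  ultimately have "almost_golomb2 b"
    unfolding almost_golomb2_def using b0 mono key by auto
  then show ?thesis by blast
qed

text \<open>The \<open>\<int>\<close>-module of integer sequences under pointwise operations.\<close>

definition int_seq_scale :: "int \<Rightarrow> (nat \<Rightarrow> int) \<Rightarrow> (nat \<Rightarrow> int)" where
  "int_seq_scale c f = (\<lambda>n. c * f n)"

interpretation int_seq: module int_seq_scale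
  by unfold_locales (auto simp: int_seq_scale_def fun_eq_iff algebra_simps)

definition kernel2 :: "(nat \<Rightarrow> int) \<Rightarrow> (nat \<Rightarrow> int) set" where
  "kernel2 f = {(\<lambda>n. f (2 ^ i * n + j)) | i j. j < 2 ^ i}"

definition regular2 :: "(nat \<Rightarrow> int) \<Rightarrow> bool" where
  "regular2 f \<longleftrightarrow> (\<exists>G. finite G \<and> int_seq.span G = int_seq.span (kernel2 f))"

end

theory Submission
  imports Defs
begin

text \<open>
  Put \<open>t n = a n + a (n - 1)\<close>, so that \<open>a (t n) = n\<close> is the defining equation.  The sequence is
  nondecreasing and, through \<open>t\<close>, takes every value, so it grows by at most \<open>1\<close> at each step.
  Together with minimality this shows that \<open>t n\<close> is the first position of the value \<open>n\<close>, that is,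
  \<open>a (t n - 1) = n - 1\<close> for \<open>n \<ge> 3\<close> (lemma \<open>first_occurrence\<close>).

  The recurrences follow by applying this twice.  For \<open>n \<ge> 2\<close> let \<open>k = t (n + 1)\<close>.  Then
  \<open>a k = n + 1\<close> and \<open>a (k - 1) = n\<close>, hence \<open>t k = 2 * n + 1\<close>; now the same two facts at \<open>k\<close> read
  \<open>a (2 * n + 1) = k\<close> and \<open>a (2 * n) = k - 1\<close>, and \<open>k = a n + a (n + 1)\<close>.

  The only failure of the recurrences is at the odd index \<open>3\<close>, where the value is too small by one.
  Indicators of single points absorb it: passing to \<open>2 * n\<close> and \<open>2 * n + 1\<close> maps the module
  generated by \<open>a n\<close>, \<open>a (n + 1)\<close>, \<open>a (n + 2)\<close>, the constant \<open>1\<close> and the indicators of \<open>0\<close> and \<open>1\<close>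
  into itself.  That module therefore contains the \<open>2\<close>-kernel; conversely, its six generators are
  integer combinations of kernel elements of level at most \<open>2\<close>, so that it is exactly the
  module spanned by the kernel.
\<close>

lemma initial_values:
  assumes "almost_golomb2 a"
  shows "a 0 = 0" "a 1 = 1" "a 2 = 2" "a 3 = 2"
proof -
  have "a 0 = 0" "\<And>n. n \<ge> 1 \<Longrightarrow> a n > 0" "\<And>m n. 1 \<le> m \<Longrightarrow> m \<le> n \<Longrightarrow> a m \<le> a n"
    and rec: "\<And>n. n \<ge> 1 \<Longrightarrow> a (a n + a (n - 1)) = n"
    using assms unfolding almost_golomb2_def by blast+
  note init = no_minimality_at_2(1,2)[of a, OF this]
  show "a 0 = 0" by fact
  show "a 1 = 1" "a 2 = 2" using init by simp_all
  then show "a 3 = 2" using rec[of 2] by (simp add: numeral_eq_Suc)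
qed

lemma slow_growth:
  assumes "almost_golomb2 a"
  shows "a (Suc x) \<le> Suc (a x)"
proof (cases "x = 0")
  case True
  then show ?thesis
    using initial_values[OF assms] by simp
next
  case False
  \<comment> \<open>The value \<open>a x + 1\<close> is attained, and by monotonicity only to the right of \<open>x\<close>.\<close>
  obtain y where y: "a y = Suc (a x)"
    using assms unfolding almost_golomb2_def by (metis Suc_eq_plus1 le_add2)
  have "Suc x \<le> y"
  proof (rule ccontr)
    assume "\<not> Suc x \<le> y"
    then have "a y \<le> a x"
      using assms False unfolding almost_golomb2_def by (cases "y = 0") auto
    then show False using y by simp
  qed
  then have "a (Suc x) \<le> a y"
    using assms unfolding almost_golomb2_def by auto
  then show ?thesis using y by simp
qed

text \<open>
  If \<open>a (n - 1) < a n\<close>, this is minimality.  Otherwise \<open>a n = a (n - 1)\<close> and minimality is vacuous;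
  but then \<open>a (n - 2) = a (n - 1) - 1\<close>, as three equal terms would put the values \<open>n - 1\<close> and \<open>n\<close> at
  the same position, and so the position before that of \<open>n\<close> is the one prescribed for \<open>n - 1\<close>.
\<close>

lemma first_occurrence:
  assumes g: "almost_golomb2 a" and n: "n \<ge> 3"
  shows "a (a n + a (n - 1) - 1) = n - 1"
proof -
  have mono: "a i \<le> a j" if "1 \<le> i" "i \<le> j" for i j
    using g that unfolding almost_golomb2_def by blast
  have pos: "a i > 0" if "1 \<le> i" for i
    using g that unfolding almost_golomb2_def by blast
  define m where "m = n - 2"
  have m: "n = m + 2" "m \<ge> 1" using n by (simp_all add: m_def)
  define s where "s = a (m + 1) + a m"
  define t where "t = a (m + 2) + a (m + 1)"
  have rec: "a (a i + a (i - 1)) = i" if "1 \<le> i" for i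
    using g that unfolding almost_golomb2_def by blast
  have as: "a s = m + 1" and at: "a t = m + 2"
    using rec[of "m + 1"] rec[of "m + 2"] by (simp_all add: s_def t_def)
  have le: "a m \<le> a (m + 1)" "a (m + 1) \<le> a (m + 2)"
    using mono m by auto
  have "s \<noteq> t" using as at by auto
  then have st: "s < t" using le by (auto simp: s_def t_def)
  have spos: "1 \<le> s" using pos[of m] m by (simp add: s_def)
  have lower: "m + 1 \<le> a (t - 1)" using mono[of s "t - 1"] st spos as by simp
  have upper: "a (t - 1) \<le> m + 2" using mono[of "t - 1" t] st spos at by simp
  have "a (t - 1) = m + 1"
  proof (cases "a (m + 1) < a (m + 2)")
    case True
    have "\<not> (\<exists>i. a (n - 1) \<le> i \<and> i < a n \<and> a (i + a (n - 1)) = n)"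
      using g n unfolding almost_golomb2_def by blast
    moreover have "a (n - 1) \<le> a (m + 2) - 1" "a (m + 2) - 1 < a n" "a (m + 2) - 1 + a (n - 1) = t - 1"
      using True m by (auto simp: t_def)
    ultimately have "a (t - 1) \<noteq> m + 2" using m by metis
    then show ?thesis using lower upper by simp
  next
    case False
    then have "a m < a (m + 1)" "a (m + 2) = a (m + 1)"
      using le st by (auto simp: s_def t_def)
    then have "t - 1 = s"
      using slow_growth[OF g, of m] by (auto simp: s_def t_def)
    then show ?thesis using as by simp
  qed
  then show ?thesis using m by (simp add: t_def)
qed

lemma doubling:
  assumes g: "almost_golomb2 a" and n: "n \<ge> 2"
  shows "a (2 * n) = a n + a (n + 1) - 1" and "a (2 * n + 1) = a n + a (n + 1)"
proof -
  have mono: "a i \<le> a j" if "1 \<le> i" "i \<le> j" for i j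
    using g that unfolding almost_golomb2_def by blast
  have rec: "a (a i + a (i - 1)) = i" if "i \<ge> 1" for i
    using g that unfolding almost_golomb2_def by blast
  define k where "k = a (n + 1) + a n"
  have k3: "k \<ge> 3"
    using mono[of 2 n] mono[of 2 "n + 1"] n initial_values(3)[OF g] by (simp add: k_def)
  have "a k = n + 1" using rec[of "n + 1"] by (simp add: k_def)
  moreover have "a (k - 1) = n" using first_occurrence[OF g, of "n + 1"] n by (simp add: k_def)
  ultimately have t: "a k + a (k - 1) = 2 * n + 1" by simp
  show "a (2 * n + 1) = a n + a (n + 1)"
    using rec[of k] t k3 by (simp add: k_def)
  show "a (2 * n) = a n + a (n + 1) - 1"
    using first_occurrence[OF g, of k] t k3 by (simp add: k_def)
qed

text \<open>
  Over the integers, with the exception at \<open>a 3\<close> made an explicit term, the recurrences extend to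
  all \<open>n\<close>; at \<open>n = 0\<close> this rests on the convention \<open>a 0 = 0\<close>.
\<close>

lemma doubling_int:
  assumes g: "almost_golomb2 a"
  shows "int (a (2 * n)) = int (a n) + int (a (n + 1)) - 1"
    and "int (a (2 * n + 1)) = int (a n) + int (a (n + 1)) - (if n = 1 then 1 else 0)"
proof -
  consider "n = 0" | "n = 1" | "n \<ge> 2" by linarith
  then have "int (a (2 * n)) = int (a n) + int (a (n + 1)) - 1
    \<and> int (a (2 * n + 1)) = int (a n) + int (a (n + 1)) - (if n = 1 then 1 else 0)"
  proof cases
    case 3
    then have "a n > 0" using g unfolding almost_golomb2_def by auto
    then show ?thesis using doubling[OF g 3] 3 by auto
  qed (use initial_values[OF g] in \<open>simp_all add: numeral_eq_Suc\<close>)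
  then show "int (a (2 * n)) = int (a n) + int (a (n + 1)) - 1"
    and "int (a (2 * n + 1)) = int (a n) + int (a (n + 1)) - (if n = 1 then 1 else 0)"
    by blast+
qed

lemma span_reindex:
  assumes gens: "\<And>g. g \<in> G \<Longrightarrow> (\<lambda>n. g (h n)) \<in> int_seq.span G"
    and f: "f \<in> int_seq.span G"
  shows "(\<lambda>n. f (h n)) \<in> int_seq.span G"
  using f
proof (induction f rule: int_seq.span_induct_alt)
  case base
  then show ?case using int_seq.span_zero[of G] by (simp add: zero_fun_def)
next
  case (step c x y)
  have "(\<lambda>n. (int_seq_scale c x + y) (h n))
      = int_seq_scale c (\<lambda>n. x (h n)) + (\<lambda>n. y (h n))"
    by (auto simp: fun_eq_iff int_seq_scale_def)
  then show ?case
    using int_seq.span_add[OF int_seq.span_scale[OF gens[OF step(1)]] step(2)] by simp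
qed

text \<open>
  Taking \<open>g (2 * n)\<close> and \<open>g (2 * n + 1)\<close> is linear in \<open>g\<close> and generates the \<open>2\<close>-kernel, so
  closure of a module under both need only be tested on generators.
\<close>

lemma kernel2_subset_span:
  assumes f: "f \<in> int_seq.span G"
    and even: "\<And>g. g \<in> G \<Longrightarrow> (\<lambda>n. g (2 * n)) \<in> int_seq.span G"
    and odd: "\<And>g. g \<in> G \<Longrightarrow> (\<lambda>n. g (2 * n + 1)) \<in> int_seq.span G"
  shows "kernel2 f \<subseteq> int_seq.span G"
proof -
  have "(\<lambda>n. f (2 ^ i * n + j)) \<in> int_seq.span G" if "j < 2 ^ i" for i j
    using that
  proof (induction i arbitrary: j)
    case 0
    then show ?case using f by simp
  next
    case (Suc i)
    \<comment> \<open>Bit \<open>i\<close> of \<open>j\<close> decides whether a level-\<open>i\<close> sequence is taken at even or at odd arguments.\<close>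
    show ?case
    proof (cases "j < 2 ^ i")
      case True
      have "(\<lambda>n. f (2 ^ Suc i * n + j)) = (\<lambda>n. f (2 ^ i * (2 * n) + j))"
        by (simp add: ac_simps)
      then show ?thesis using span_reindex[where h = "\<lambda>n. 2 * n", OF even Suc.IH[OF True]] by (simp only:)
    next
      case False
      then have j: "j - 2 ^ i < 2 ^ i" using Suc.prems by simp
      have "2 ^ Suc i * n + j = 2 ^ i * (2 * n + 1) + (j - 2 ^ i)" for n
        using False by (simp add: algebra_simps)
      then have "(\<lambda>n. f (2 ^ Suc i * n + j)) = (\<lambda>n. f (2 ^ i * (2 * n + 1) + (j - 2 ^ i)))"
        by presburger
      then show ?thesis using span_reindex[where h = "\<lambda>n. 2 * n + 1", OF odd Suc.IH[OF j]] by (simp only:)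
    qed
  qed
  then show ?thesis unfolding kernel2_def by blast
qed

lemma almost_golomb2_regular2:
  assumes g: "almost_golomb2 a"
  shows "regular2 (\<lambda>n. int (a n))"
proof -
  define f where "f = (\<lambda>n. int (a n))"
  define f1 where "f1 = (\<lambda>n. f (n + 1))"
  define f2 where "f2 = (\<lambda>n. f (n + 2))"
  define one where "one = (\<lambda>n::nat. 1::int)"
  define d0 where "d0 = (\<lambda>n::nat. if n = 0 then 1 else 0::int)"
  define d1 where "d1 = (\<lambda>n::nat. if n = 1 then 1 else 0::int)"
  define G where "G = {f, f1, f2, one, d0, d1}"
  note defs = f1_def f2_def one_def d0_def d1_def
  have ev: "f (2 * n) = f n + f (n + 1) - 1" for n
    using doubling_int(1)[OF g, of n] by (simp add: f_def)
  have od: "f (2 * n + 1) = f n + f (n + 1) - d1 n" for n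
    using doubling_int(2)[OF g, of n] by (simp add: f_def d1_def)
  have r2: "f (2 * n + 2) = f (n + 1) + f (n + 2) - 1" for n
    using ev[of "n + 1"] by simp
  have r3: "f (2 * n + 3) = f (n + 1) + f (n + 2) - d0 n" for n
    using od[of "n + 1"] by (simp add: d0_def d1_def numeral_3_eq_3)

  have base: "x \<in> int_seq.span G" if "x \<in> G" for x
    using that by (rule int_seq.span_base)
  have b: "f \<in> int_seq.span G" "f1 \<in> int_seq.span G" "f2 \<in> int_seq.span G"
    "one \<in> int_seq.span G" "d0 \<in> int_seq.span G" "d1 \<in> int_seq.span G"
    by (rule base, simp add: G_def)+
  have mem: "x = f \<or> x = f1 \<or> x = f2 \<or> x = one \<or> x = d0 \<or> x = d1" if "x \<in> G" for x
    using that by (simp add: G_def)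
  note cl = int_seq.span_add int_seq.span_diff b int_seq.span_zero
  have "(\<lambda>n. f (2 * n)) = f + f1 - one" "(\<lambda>n. f1 (2 * n)) = f + f1 - d1"
    "(\<lambda>n. f2 (2 * n)) = f1 + f2 - one" "(\<lambda>n. one (2 * n)) = one"
    "(\<lambda>n. d0 (2 * n)) = d0" "(\<lambda>n. d1 (2 * n)) = 0"
    using ev od r2 by (auto simp: fun_eq_iff defs)
  note even_eqs = this
  have even: "(\<lambda>n. x (2 * n)) \<in> int_seq.span G" if "x \<in> G" for x
    using mem[OF that] by (elim disjE) (simp_all only: even_eqs cl)
  have "(\<lambda>n. f (2 * n + 1)) = f + f1 - d1" "(\<lambda>n. f1 (2 * n + 1)) = f1 + f2 - one"
    "(\<lambda>n. f2 (2 * n + 1)) = f1 + f2 - d0" "(\<lambda>n. one (2 * n + 1)) = one"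
    "(\<lambda>n. d0 (2 * n + 1)) = 0" "(\<lambda>n. d1 (2 * n + 1)) = d0"
    using od r2 r3 by (auto simp: fun_eq_iff defs numeral_3_eq_3)
  note odd_eqs = this
  have odd: "(\<lambda>n. x (2 * n + 1)) \<in> int_seq.span G" if "x \<in> G" for x
    using mem[OF that] by (elim disjE) (simp_all only: odd_eqs cl)

  let ?K = "int_seq.span (kernel2 f)"
  have ker: "(\<lambda>n. f (2 ^ i * n + j)) \<in> ?K" if "j < 2 ^ i" for i j
    by (rule int_seq.span_base) (use that in \<open>auto simp: kernel2_def\<close>)
  have k0: "f \<in> ?K" using ker[of 0 0] by simp
  have k20: "(\<lambda>n. f (2 * n)) \<in> ?K" and k21: "(\<lambda>n. f (2 * n + 1)) \<in> ?K"
    using ker[of 0 1] ker[of 1 1] by simp_all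
  have k40: "(\<lambda>n. f (4 * n)) \<in> ?K" and k42: "(\<lambda>n. f (4 * n + 2)) \<in> ?K"
    and k43: "(\<lambda>n. f (4 * n + 3)) \<in> ?K"
    using ker[of 0 2] ker[of 2 2] ker[of 3 2] by simp_all
  have e4: "f (4 * n) = f (2 * n) + f (2 * n + 1) - 1" for n
    using ev[of "2 * n"] by simp
  have e42: "f (4 * n + 2) = f (2 * n + 1) + f (2 * n + 2) - 1" for n
    using r2[of "2 * n"] by simp
  have e43: "f (4 * n + 3) = f (2 * n + 1) + f (2 * n + 2) - d0 n" for n
    using r3[of "2 * n"] by (simp add: d0_def)
  note kcl = int_seq.span_add int_seq.span_diff
  \<comment> \<open>Level \<open>2\<close> supplies the constant, which then frees the other generators one at a time.\<close>
  have "one = (\<lambda>n. f (2 * n)) + (\<lambda>n. f (2 * n + 1)) - (\<lambda>n. f (4 * n))"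
    using e4 by (simp add: fun_eq_iff one_def)
  then have one: "one \<in> ?K" using k20 k21 k40 by (simp only: kcl)
  have "f1 = (\<lambda>n. f (2 * n)) - f + one"
    using ev by (simp add: fun_eq_iff f1_def one_def)
  then have f1: "f1 \<in> ?K" using k20 k0 one by (simp only: kcl)
  have "d1 = f + f1 - (\<lambda>n. f (2 * n + 1))"
    using od by (simp add: fun_eq_iff f1_def)
  then have d1: "d1 \<in> ?K" using k21 k0 f1 by (simp only: kcl)
  have "f2 = (\<lambda>n. f (4 * n + 2)) - (\<lambda>n. f (2 * n + 1)) - f1 + one + one"
    using e42 r2 by (simp add: fun_eq_iff f1_def f2_def one_def)
  then have f2: "f2 \<in> ?K" using k42 k21 f1 one by (simp only: kcl)
  have "d0 = (\<lambda>n. f (4 * n + 2)) - (\<lambda>n. f (4 * n + 3)) + one"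
    using e42 e43 by (simp add: fun_eq_iff one_def)
  then have d0: "d0 \<in> ?K" using k42 k43 one by (simp only: kcl)
  have "G \<subseteq> ?K" using k0 f1 f2 one d0 d1 by (simp add: G_def)
  moreover have "kernel2 f \<subseteq> int_seq.span G"
    using kernel2_subset_span[OF b(1) even odd] .
  ultimately have "int_seq.span G = ?K"
    using int_seq.span_eq[of G "kernel2 f"] by blast
  moreover have "finite G" by (simp add: G_def)
  ultimately show ?thesis unfolding regular2_def f_def by blast
qed

theorem theorem3p3:
  fixes a :: "nat \<Rightarrow> nat"
  assumes "almost_golomb2 a"
  shows "(\<forall>n\<ge>1. int (a (2 * n)) = int (a n) + int (a (n + 1)) - 1) \<and>
         (\<forall>n\<ge>2. a (2 * n + 1) = a n + a (n + 1)) \<and>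
         regular2 (\<lambda>n. int (a n))"
  using doubling_int(1)[OF assms] doubling(2)[OF assms] almost_golomb2_regular2[OF assms] by blast

end
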